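(* Let $R \subseteq S$ be integral domains with the same fraction field, such that $S$ is finitely generated as a module over $R$. Then $R$ is Egyptian if and only if $S$ is Egyptian; and $R$ is generically Egyptian if and only if $S$ is generically Egyptian.
   Context: An element of the fraction field of an integral domain $D$ is called Egyptian (with respect to $D$) if it can be written as a finite sum $\frac{1}{d_1}+\cdots+\frac{1}{d_n}$ with $d_1,\ldots,d_n$ distinct nonzero elements of $D$. An integral domain $D$ is called Egyptian if every nonzero element of $D$ is Egyptian. An integral domain $D$ is generically Egyptian if there is some nonzero $f\in D$ such that $D[1/f]$ is Egyptian. All rings are commutative with identity. *)

theory Defs
  imports "HOL-Algebra.Algebra"
begin

text \<open>
  Domains are represented as subdomains \<open>D\<close> of an ambient field \<open>K\<close>, so that fractions of elements
  of \<open>D\<close> are computed in \<open>K\<close>. The field \<open>K\<close> may be larger than the fraction field of \<open>D\<close>.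
\<close>

definition frac_field :: "('a, 'b) ring_scheme \<Rightarrow> 'a set \<Rightarrow> 'a set" where
  "frac_field K D = {a \<otimes>\<^bsub>K\<^esub> inv\<^bsub>K\<^esub> b | a b. a \<in> D \<and> b \<in> D - {\<zero>\<^bsub>K\<^esub>}}"

text \<open>
  The distinct denominators are given by the finite set \<open>T\<close>, nonempty because the sum has
  \<open>n \<ge> 1\<close> terms. Such a sum always lies in \<open>frac_field K D\<close> when \<open>D\<close> is a subdomain of \<open>K\<close>.
\<close>

definition egyptian_element :: "('a, 'b) ring_scheme \<Rightarrow> 'a set \<Rightarrow> 'a \<Rightarrow> bool" where
  "egyptian_element K D x \<longleftrightarrow>
     (\<exists>T. finite T \<and> T \<noteq> {} \<and> T \<subseteq> D - {\<zero>\<^bsub>K\<^esub>} \<and> x = (\<Oplus>\<^bsub>K\<^esub>d\<in>T. inv\<^bsub>K\<^esub> d))"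

definition egyptian :: "('a, 'b) ring_scheme \<Rightarrow> 'a set \<Rightarrow> bool" where
  "egyptian K D \<longleftrightarrow> (\<forall>x \<in> D - {\<zero>\<^bsub>K\<^esub>}. egyptian_element K D x)"

text \<open>
  \<^const>\<open>ring.simple_extension\<close> applied to \<open>K\<close>, \<open>D\<close>, \<open>x\<close> is the subring \<open>D[x]\<close> of \<open>K\<close>; here
  \<open>x = 1/f\<close>.
\<close>

definition generically_egyptian :: "('a, 'b) ring_scheme \<Rightarrow> 'a set \<Rightarrow> bool" where
  "generically_egyptian K D \<longleftrightarrow>
     (\<exists>f \<in> D - {\<zero>\<^bsub>K\<^esub>}. egyptian K (ring.simple_extension K D (inv\<^bsub>K\<^esub> f)))"

text \<open>
  \<^const>\<open>ring.Span\<close> applied to \<open>K\<close>, \<open>R\<close>, \<open>Us\<close> is the set of \<open>R\<close>-linear combinations of the list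
  \<open>Us\<close>; despite its usual application to vector spaces, \<open>R\<close> need not be a field.
\<close>

definition module_finite :: "('a, 'b) ring_scheme \<Rightarrow> 'a set \<Rightarrow> 'a set \<Rightarrow> bool" where
  "module_finite K R S \<longleftrightarrow> (\<exists>Us. set Us \<subseteq> S \<and> S = ring.Span K R Us)"

end

theory Submission
  imports Defs "HOL-Analysis.Harmonic_Numbers"
begin

text \<open>
  For a domain \<open>D\<close>, let \<open>E(D)\<close> be the set of all elements that are zero or Egyptian. The key fact
  is that \<open>E(D)\<close> is closed under addition and multiplication and contains every \<open>1/d\<close>. Hence \<open>D\<close>
  is Egyptian iff \<open>D \<subseteq> E(D)\<close>, and then \<open>E(D)\<close> contains the whole fraction field of \<open>D\<close>. Two
  transfer principles follow.

  \<^item> Ascent (\<open>egyptian_overring\<close>): if \<open>D\<close> is Egyptian, so is every ring \<open>E\<close> between \<open>D\<close> and its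
    fraction field, since \<open>E \<subseteq> E(D) \<subseteq> E(E)\<close>.
  \<^item> Descent (\<open>egyptian_conductor_descent\<close>): let \<open>D \<subseteq> E\<close> and let \<open>c \<in> D\<close> be nonzero with
    \<open>c E \<subseteq> D\<close>. If \<open>c x = 1/e\<^sub>1 + \<dots> + 1/e\<^sub>n\<close> with \<open>e\<^sub>i \<in> E\<close>, then
    \<open>x = 1/(c e\<^sub>1) + \<dots> + 1/(c e\<^sub>n)\<close>, and the new denominators lie in \<open>D\<close>.

  A module-finite extension with the same fraction field has such a \<open>c\<close>: a common denominator of
  the generators (\<open>Span_common_denominator\<close>). The generic statement reduces to ascent as well: if
  \<open>E[1/f]\<close> is Egyptian then \<open>D[1/(c f)]\<close> contains both \<open>E\<close> and \<open>1/f\<close>, so it is a ring between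
  \<open>E[1/f]\<close> and the common fraction field.

  The only real difficulty is that \<open>E(D)\<close> is closed under addition although the denominators in
  each sum must be distinct, so repeated unit fractions have to be removed. If \<open>2 = 0\<close> or
  \<open>1/2 \<in> D\<close>, which is always the case in positive characteristic, then \<open>1/d + 1/d\<close> is zero or a
  single unit fraction \<open>1/(d/2)\<close>, so collapsing repetitions shortens the sum and terminates. In
  characteristic zero, \<open>1\<close> is a sum of distinct unit fractions \<open>1/n\<close> with all \<open>n\<close> arbitrarily large
  (\<open>one_eq_sum_large_unit_fractions\<close>), and so \<open>1/d\<close> is the sum of the \<open>1/(d n)\<close>, which can be made
  to avoid any finite set of denominators already in use.
\<close>

section \<open>Egyptian fractions with large denominators\<close>

text \<open>
  The greedy algorithm of Fibonacci: subtract the largest unit fraction \<open>1/n \<le> a/b\<close>. The numerator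
  drops to \<open>a n - b < a\<close>, so the process stops. The remainder is less than \<open>1/n\<close>, so the next
  denominators exceed \<open>n\<close>; this keeps them distinct and above the initial bound.
\<close>

lemma greedy_unit_fractions:
  fixes a b N :: nat
  assumes "0 < a" "0 < N" "a * N < b"
  shows "\<exists>T. finite T \<and> T \<subseteq> {N<..} \<and> (\<Sum>n\<in>T. 1 / real n) = real a / real b"
  using assms
proof (induction a arbitrary: b N rule: less_induct)
  case (less a)
  \<comment> \<open>the ceiling of \<open>b / a\<close>\<close>
  define n where "n = (b + a - 1) div a"
  have "b + a - 1 = a * n + (b + a - 1) mod a" by (simp add: n_def)
  moreover have "(b + a - 1) mod a < a" using less.prems by simp
  ultimately have n_lower: "b \<le> a * n" and n_upper: "a * n < b + a"
    using less.prems by linarith+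
  have "a * N < a * n" using less.prems n_lower by linarith
  hence "N < n" by simp
  have "a \<le> a * N" using less.prems by simp
  hence "a < b" "0 < b" using less.prems by linarith+
  show ?case
  proof (cases "a * n = b")
    case True
    hence "1 / real n = real a / real b"
      using less.prems \<open>N < n\<close> by auto
    thus ?thesis
      using \<open>N < n\<close> by (intro exI[of _ "{n}"]) simp
  next
    case False
    define a' where "a' = a * n - b"
    have "0 < a'" "a' < a" "0 < n" 
      using False n_lower n_upper \<open>N < n\<close> unfolding a'_def by linarith+
    moreover have "a' * n < b * n"
      using \<open>a' < a\<close> \<open>a < b\<close> \<open>0 < n\<close> by simp
    ultimately obtain T where T: "finite T" "T \<subseteq> {n<..}"
      "(\<Sum>k\<in>T. 1 / real k) = real a' / real (b * n)"
      using less.IH[of a' n "b * n"] by blast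
    have "real a' = real a * real n - real b"
      using n_lower unfolding a'_def by (simp add: of_nat_diff)
    hence "1 / real n + real a' / real (b * n) = real a / real b"
      using \<open>0 < n\<close> \<open>0 < b\<close> by (simp add: field_simps)
    moreover have "n \<notin> T" using T by auto
    ultimately have "(\<Sum>k\<in>insert n T. 1 / real k) = real a / real b"
      using T by simp
    thus ?thesis
      using T \<open>N < n\<close> by (intro exI[of _ "insert n T"]) auto
  qed
qed

text \<open>
  As the harmonic series diverges, \<open>1/(N+1) + 1/(N+2) + \<dots>\<close> can be summed up to the last term
  \<open>1/L\<close> before the partial sum exceeds \<open>1\<close>. What is missing then is less than \<open>1/(L+1)\<close>, so the
  greedy algorithm supplies it with denominators larger than \<open>L\<close>.
\<close>

lemma one_eq_sum_large_unit_fractions: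
  fixes N :: nat
  shows "\<exists>T. finite T \<and> T \<subseteq> {N<..} \<and> (\<Sum>n\<in>T. 1 / real n) = 1"
proof -
  define S where "S M = (\<Sum>n\<in>{N<..M}. 1 / real n)" for M
  have harm_split: "harm M = harm N + S M" if "N \<le> M" for M
  proof -
    have "{1..M} = {1..N} \<union> {N<..M}" using that by auto
    thus ?thesis
      unfolding S_def harm_def
      by (simp add: inverse_eq_divide) (intro sum.union_disjoint, auto)
  qed
  have "\<forall>\<^sub>F M in sequentially. harm N + 1 < (harm M :: real)"
    using harm_at_top unfolding filterlim_at_top_dense by blast
  then obtain M0 where "\<And>M. M0 \<le> M \<Longrightarrow> harm N + 1 < (harm M :: real)"
    unfolding eventually_sequentially by blast
  hence ex: "\<exists>M. 1 < S M"
    using harm_split[of "max M0 N"] by (intro exI[of _ "max M0 N"]) (smt (verit) max.cobounded1 max.cobounded2)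
  define M where "M = (LEAST M. 1 < S M)"
  have M: "1 < S M" unfolding M_def using ex by (rule LeastI_ex)
  have "N < M"
    using M unfolding S_def by (cases "N < M") auto
  then obtain L where L: "M = Suc L" "N \<le> L" by (cases M) auto
  have "S L \<le> 1"
    using not_less_Least[of L "\<lambda>M. 1 < S M"] L unfolding M_def by force
  have "{N<..Suc L} = insert (Suc L) {N<..L}" using L by auto
  hence S_Suc: "S M = S L + 1 / real (Suc L)" unfolding S_def L by simp
  show ?thesis
  proof (cases "S L = 1")
    case True
    thus ?thesis unfolding S_def by (intro exI[of _ "{N<..L}"]) auto
  next
    case False
    have "S L \<in> \<rat>" unfolding S_def by (intro Rats_sum) simp
    hence "1 - S L \<in> \<rat>" by simp
    then obtain a b :: nat where ab: "b \<noteq> 0" "\<bar>1 - S L\<bar> = real a / real b"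
      by (rule Rats_abs_nat_div_natE)
    hence rest: "1 - S L = real a / real b" "0 < real a / real b"
      using False \<open>S L \<le> 1\<close> by auto
    hence "0 < a" by (cases a) auto
    have "real a / real b < 1 / real (Suc L)" using M S_Suc rest by linarith
    hence "real a * real (Suc L) < real b"
      using ab(1) by (simp add: field_simps)
    hence "a * Suc L < b" by (metis of_nat_less_iff of_nat_mult)
    then obtain T where T: "finite T" "T \<subseteq> {Suc L<..}" "(\<Sum>n\<in>T. 1 / real n) = real a / real b"
      using greedy_unit_fractions[OF \<open>0 < a\<close>, of "Suc L" b] by auto
    have "(\<Sum>n\<in>{N<..L} \<union> T. 1 / real n) = S L + (\<Sum>n\<in>T. 1 / real n)"
      unfolding S_def using T by (intro sum.union_disjoint) auto
    also have "\<dots> = 1" using T rest by simp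
    finally show ?thesis
      using T L by (intro exI[of _ "{N<..L} \<union> T"]) auto
  qed
qed

section \<open>Unit fractions in a field\<close>

context field
begin

abbreviation of_natural :: "nat \<Rightarrow> 'a" where
  "of_natural n \<equiv> add_pow R n \<one>"

lemma of_natural_add: "of_natural (m + n) = of_natural m \<oplus> of_natural n"
  by (simp add: add.nat_pow_mult)

lemma of_natural_mult: "of_natural (m * n) = of_natural m \<otimes> of_natural n"
  using add_pow_ldistr[of \<one> "of_natural n" m] add.nat_pow_pow[of \<one> m n]
  by (simp add: mult.commute)

lemma inv_nonzero:
  assumes "x \<in> carrier R - {\<zero>}"
  shows "inv x \<in> carrier R - {\<zero>}" "x \<otimes> inv x = \<one>" "inv x \<otimes> x = \<one>"
  using assms field_Units Units_inv_Units[of x] by auto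

lemma inv_mult_nonzero:
  assumes "x \<in> carrier R - {\<zero>}" "y \<in> carrier R - {\<zero>}"
  shows "inv (x \<otimes> y) = inv x \<otimes> inv y"
proof (rule comm_inv_char)
  have "x \<otimes> y \<otimes> (inv x \<otimes> inv y) = (x \<otimes> inv x) \<otimes> (y \<otimes> inv y)"
    using assms inv_nonzero[OF assms(1)] inv_nonzero[OF assms(2)] by (simp add: m_ac)
  thus "x \<otimes> y \<otimes> (inv x \<otimes> inv y) = \<one>"
    using assms by (simp add: inv_nonzero)
qed (use assms inv_nonzero in auto)

lemma mult_right_inj_on: "x \<in> carrier R - {\<zero>} \<Longrightarrow> inj_on (\<lambda>y. x \<otimes> y) (carrier R)"
  by (rule inj_onI) (use m_lcancel in auto)

lemma finsum_inv_scale: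
  assumes "c \<in> carrier R - {\<zero>}" "finite T" "T \<subseteq> carrier R - {\<zero>}"
  shows "(\<Oplus>d\<in>(\<lambda>y. c \<otimes> y) ` T. inv d) = inv c \<otimes> (\<Oplus>d\<in>T. inv d)"
proof -
  have nz: "c \<otimes> d \<in> carrier R - {\<zero>}" if "d \<in> T" for d
    using that assms integral by auto
  have "inj_on (\<lambda>y. c \<otimes> y) T"
    using assms(3) by (intro inj_on_subset[OF mult_right_inj_on[OF assms(1)]]) auto
  moreover have "(\<lambda>d. inv d) \<in> (\<lambda>y. c \<otimes> y) ` T \<rightarrow> carrier R"
    using inv_nonzero(1)[OF nz] by auto
  ultimately have "(\<Oplus>d\<in>(\<lambda>y. c \<otimes> y) ` T. inv d) = (\<Oplus>d\<in>T. inv (c \<otimes> d))"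
    by (intro finsum_reindex)
  also have "\<dots> = (\<Oplus>d\<in>T. inv c \<otimes> inv d)"
    using assms inv_nonzero(1) inv_mult_nonzero[OF assms(1)]
    by (intro finsum_cong') (auto simp: subset_iff)
  also have "\<dots> = inv c \<otimes> (\<Oplus>d\<in>T. inv d)"
    using assms inv_nonzero(1) by (intro finsum_rdistr[symmetric]) auto
  finally show ?thesis .
qed

lemma add_fractions:
  assumes "a \<in> carrier R" "b \<in> carrier R - {\<zero>}" "c \<in> carrier R" "d \<in> carrier R - {\<zero>}"
  shows "a \<otimes> inv b \<oplus> c \<otimes> inv d = (a \<otimes> d \<oplus> c \<otimes> b) \<otimes> inv (b \<otimes> d)"
proof -
  have ib: "inv b \<in> carrier R" and id: "inv d \<in> carrier R"
    using assms inv_nonzero by auto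
  have "(a \<otimes> d \<oplus> c \<otimes> b) \<otimes> (inv b \<otimes> inv d)
      = a \<otimes> inv b \<otimes> (d \<otimes> inv d) \<oplus> c \<otimes> inv d \<otimes> (b \<otimes> inv b)"
    using assms ib id by (simp add: l_distr r_distr m_ac)
  thus ?thesis
    using assms ib id by (simp add: inv_mult_nonzero inv_nonzero)
qed

text \<open>
  Carries identities between sums of unit fractions from the real numbers into a field of
  characteristic zero: both sums are represented by the same numerator and denominator.
\<close>

lemma finsum_unit_fractions_transfer:
  assumes char0: "\<And>n. 0 < n \<Longrightarrow> of_natural n \<noteq> \<zero>"
    and "finite T" "T \<subseteq> {0<..}"
  shows "\<exists>a b. 0 < b \<and> (\<Sum>n\<in>T. 1 / real n) = real a / real b
    \<and> (\<Oplus>n\<in>T. inv (of_natural n)) = of_natural a \<otimes> inv (of_natural b)"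
  using assms(2,3)
proof (induction T)
  case empty
  show ?case by (intro exI[of _ 0] exI[of _ 1]) simp
next
  case (insert n T)
  then obtain a b where ab: "0 < b" "(\<Sum>n\<in>T. 1 / real n) = real a / real b"
    "(\<Oplus>n\<in>T. inv (of_natural n)) = of_natural a \<otimes> inv (of_natural b)" by auto
  have n: "0 < n" using insert by auto
  have nz: "of_natural k \<in> carrier R - {\<zero>}" if "0 < k" for k using char0[OF that] by simp
  have "(\<Sum>k\<in>insert n T. 1 / real k) = real (b + a * n) / real (n * b)"
    using insert ab n by (simp add: field_simps)
  moreover have "(\<Oplus>k\<in>insert n T. inv (of_natural k))
      = inv (of_natural n) \<oplus> (\<Oplus>k\<in>T. inv (of_natural k))"
    using insert nz inv_nonzero(1) by (intro finsum_insert) auto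
  moreover have "\<dots> = \<one> \<otimes> inv (of_natural n) \<oplus> of_natural a \<otimes> inv (of_natural b)"
    using ab inv_nonzero(1)[OF nz[OF n]] by simp
  moreover have "\<dots> = of_natural (b + a * n) \<otimes> inv (of_natural (n * b))"
    using add_fractions[OF one_closed nz[OF n] _ nz[OF ab(1)], of "of_natural a"]
    by (simp add: of_natural_add of_natural_mult)
  ultimately show ?case
    using n ab(1) by (intro exI[of _ "b + a * n"] exI[of _ "n * b"]) simp
qed

lemma subring_of_natural: "subring D R \<Longrightarrow> of_natural n \<in> D"
  by (induction n) (auto intro: subringE(2,3,7))

text \<open>
  Write \<open>1\<close> as a sum of distinct \<open>1/n\<close> and divide by \<open>d\<close>. The map \<open>n \<mapsto> d n\<close> is injective in
  characteristic zero, so the finite set \<open>B\<close> contains \<open>d n\<close> for only finitely many \<open>n\<close>, and taking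
  all \<open>n\<close> large avoids it.
\<close>

lemma inv_eq_sum_avoiding:
  assumes char0: "\<And>n. 0 < n \<Longrightarrow> of_natural n \<noteq> \<zero>"
    and D: "subring D R" and d: "d \<in> D - {\<zero>}" and "finite B"
  shows "\<exists>T. finite T \<and> T \<subseteq> D - {\<zero>} \<and> T \<inter> B = {} \<and> (\<Oplus>t\<in>T. inv t) = inv d"
proof -
  have dR: "d \<in> carrier R - {\<zero>}" using d subringE(1)[OF D] by auto
  have no_collision: "of_natural m \<noteq> of_natural n" if "m < n" for m n
  proof
    assume "of_natural m = of_natural n"
    moreover have "of_natural n = of_natural m \<oplus> of_natural (n - m)"
      using of_natural_add[of m "n - m"] that by simp
    ultimately have "of_natural m \<oplus> of_natural (n - m) = of_natural m \<oplus> \<zero>" by simp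
    hence "of_natural (n - m) = \<zero>" by (subst (asm) add.l_cancel) auto
    thus False using char0[of "n - m"] that by simp
  qed
  hence inj_nat: "inj of_natural"
    by (intro injI) (metis linorder_neqE_nat)
  have inj: "inj (\<lambda>n. d \<otimes> of_natural n)"
  proof (rule injI)
    fix m n assume "d \<otimes> of_natural m = d \<otimes> of_natural n"
    hence "of_natural m = of_natural n"
      using dR m_lcancel[of d "of_natural m" "of_natural n"] by simp
    thus "m = n" by (rule injD[OF inj_nat])
  qed
  have "finite {n. d \<otimes> of_natural n \<in> B}"
    using finite_vimageI[OF \<open>finite B\<close> inj] by (simp add: vimage_def)
  then obtain N where N: "\<And>n. d \<otimes> of_natural n \<in> B \<Longrightarrow> n \<le> N"
    unfolding finite_nat_set_iff_bounded_le by auto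
  obtain U where U: "finite U" "U \<subseteq> {N<..}" "(\<Sum>n\<in>U. 1 / real n) = 1"
    using one_eq_sum_large_unit_fractions by blast
  have "U \<subseteq> {0<..}" using U(2) by auto
  then obtain a b where ab: "0 < b" "1 = real a / real b"
    "(\<Oplus>n\<in>U. inv (of_natural n)) = of_natural a \<otimes> inv (of_natural b)"
    using finsum_unit_fractions_transfer[OF char0 U(1)] unfolding U(3) by blast
  have nz: "of_natural k \<in> carrier R - {\<zero>}" if "0 < k" for k using char0[OF that] by simp
  have nzU: "of_natural ` U \<subseteq> carrier R - {\<zero>}" using U nz by auto
  have "a = b" using ab by (simp add: field_simps)
  hence U1: "(\<Oplus>n\<in>U. inv (of_natural n)) = \<one>" using ab nz[OF ab(1)] by (simp add: inv_nonzero)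
  have "(\<Oplus>t\<in>of_natural ` U. inv t) = (\<Oplus>n\<in>U. inv (of_natural n))"
    using nzU inv_nonzero(1) inj_on_subset[OF inj_nat] by (intro finsum_reindex) auto
  hence "(\<Oplus>t\<in>(\<lambda>y. d \<otimes> y) ` of_natural ` U. inv t) = inv d"
    using finsum_inv_scale[OF dR _ nzU] U U1 inv_nonzero(1)[OF dR] by simp
  moreover have "d \<otimes> of_natural n \<in> D - {\<zero>}" if "n \<in> U" for n
    using that nzU subring_of_natural[OF D, of n] subringE(6)[OF D] d dR
      integral[of d "of_natural n"] by auto
  hence "(\<lambda>y. d \<otimes> y) ` of_natural ` U \<subseteq> D - {\<zero>}" by auto
  moreover have "d \<otimes> of_natural n \<notin> B" if "n \<in> U" for n
    using N[of n] U(2) that by auto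
  hence "((\<lambda>y. d \<otimes> y) ` of_natural ` U) \<inter> B = {}" by blast
  ultimately show ?thesis
    using U by (intro exI[of _ "(\<lambda>y. d \<otimes> y) ` of_natural ` U"]) auto
qed

text \<open>
  Let \<open>p\<close> be the least positive integer vanishing in the field. If \<open>p = 2 m\<close>, then
  \<open>m \<noteq> 0\<close> in the field by minimality, so \<open>2 = 0\<close>; if \<open>p = 2 m + 1\<close>, then \<open>m + 1\<close> is an inverse of \<open>2\<close>.
\<close>

lemma two_zero_or_unit:
  assumes "subring D R" "0 < n" "of_natural n = \<zero>"
  shows "of_natural 2 = \<zero> \<or> (\<exists>h\<in>D. of_natural 2 \<otimes> h = \<one>)"
proof -
  define p where "p = (LEAST n. 0 < n \<and> of_natural n = \<zero>)"
  have p: "0 < p" "of_natural p = \<zero>"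
    using LeastI[of "\<lambda>n. 0 < n \<and> of_natural n = \<zero>" n] assms unfolding p_def by auto
  have minimal: "of_natural m \<noteq> \<zero>" if "0 < m" "m < p" for m
    using not_less_Least[of m "\<lambda>n. 0 < n \<and> of_natural n = \<zero>"] that unfolding p_def by auto
  show ?thesis
  proof (cases "even p")
    case True
    then obtain m where m: "p = 2 * m" by auto
    hence "of_natural 2 \<otimes> of_natural m = \<zero>" using p of_natural_mult by metis
    moreover have "of_natural m \<noteq> \<zero>" using minimal[of m] m p by auto
    ultimately show ?thesis using integral by auto
  next
    case False
    then obtain m where m: "p = 2 * m + 1" by (auto elim: oddE)
    have "of_natural 2 \<otimes> of_natural (m + 1) = of_natural (p + 1)"
      unfolding of_natural_mult[symmetric] m by simp
    also have "\<dots> = \<one>" using p by (simp add: of_natural_add)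
    finally show ?thesis using subring_of_natural[OF assms(1)] by blast
  qed
qed

section \<open>The ring of sums of unit fractions\<close>

text \<open>
  Adjoining zero to the Egyptian elements amounts to admitting the empty sum. When the field has
  two elements, zero is not Egyptian.
\<close>

definition unit_fraction_sums :: "'a set \<Rightarrow> 'a set" where
  "unit_fraction_sums D = insert \<zero> {x. egyptian_element R D x}"

lemma unit_fraction_sums_iff:
  "x \<in> unit_fraction_sums D \<longleftrightarrow> (\<exists>T. finite T \<and> T \<subseteq> D - {\<zero>} \<and> x = (\<Oplus>d\<in>T. inv d))"
proof
  assume "x \<in> unit_fraction_sums D"
  hence "x = (\<Oplus>d\<in>{}. inv d) \<or> egyptian_element R D x"
    unfolding unit_fraction_sums_def by simp
  thus "\<exists>T. finite T \<and> T \<subseteq> D - {\<zero>} \<and> x = (\<Oplus>d\<in>T. inv d)"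
    unfolding egyptian_element_def by blast
next
  assume "\<exists>T. finite T \<and> T \<subseteq> D - {\<zero>} \<and> x = (\<Oplus>d\<in>T. inv d)"
  then obtain T where T: "finite T" "T \<subseteq> D - {\<zero>}" "x = (\<Oplus>d\<in>T. inv d)" by blast
  show "x \<in> unit_fraction_sums D"
  proof (cases "T = {}")
    case True
    thus ?thesis using T unfolding unit_fraction_sums_def by simp
  next
    case False
    thus ?thesis using T unfolding unit_fraction_sums_def egyptian_element_def by blast
  qed
qed

lemma egyptian_iff_subset: "egyptian R D \<longleftrightarrow> D \<subseteq> unit_fraction_sums D"
  unfolding egyptian_def unit_fraction_sums_def by auto

context
  fixes D assumes D: "subring D R"
begin

lemma subring_nonzero: "d \<in> D - {\<zero>} \<Longrightarrow> d \<in> carrier R - {\<zero>}"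
  using subringE(1)[OF D] by auto

lemma finsum_inv_closed: "T \<subseteq> D - {\<zero>} \<Longrightarrow> (\<Oplus>d\<in>T. inv d) \<in> carrier R"
  using subring_nonzero inv_nonzero(1) by (intro finsum_closed) auto

lemma unit_fraction_sums_closed: "x \<in> unit_fraction_sums D \<Longrightarrow> x \<in> carrier R"
  unfolding unit_fraction_sums_iff using finsum_inv_closed by auto

lemma finsum_inv_insert:
  "\<lbrakk>finite T; T \<subseteq> D - {\<zero>}; d \<in> D - {\<zero>}; d \<notin> T\<rbrakk>
    \<Longrightarrow> (\<Oplus>t\<in>insert d T. inv t) = inv d \<oplus> (\<Oplus>t\<in>T. inv t)"
  using subring_nonzero inv_nonzero(1) by (intro finsum_insert) auto

text \<open>
  If \<open>d\<close> already occurs in \<open>T\<close>, the two copies of \<open>1/d\<close> cancel or merge into \<open>1/(h d)\<close> where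
  \<open>h = 1/2\<close>. The new denominator may occur in \<open>T\<close> again, but \<open>T\<close> has lost an element, which gives
  the induction on its cardinality.
\<close>

lemma add_inv_if_two_zero_or_unit:
  assumes two: "of_natural 2 = \<zero> \<or> (\<exists>h\<in>D. of_natural 2 \<otimes> h = \<one>)"
    and "finite T" "T \<subseteq> D - {\<zero>}" "d \<in> D - {\<zero>}"
  shows "(\<Oplus>t\<in>T. inv t) \<oplus> inv d \<in> unit_fraction_sums D"
  using assms(2-)
proof (induction "card T" arbitrary: T d rule: less_induct)
  case less
  show ?case
  proof (cases "d \<in> T")
    case False
    have "(\<Oplus>t\<in>T. inv t) \<oplus> inv d = (\<Oplus>t\<in>insert d T. inv t)"
      using finsum_inv_insert[of T d] False less.prems finsum_inv_closed
        inv_nonzero(1)[OF subring_nonzero] by (simp add: a_comm)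
    thus ?thesis
      unfolding unit_fraction_sums_iff using less.prems by (intro exI[of _ "insert d T"]) auto
  next
    case True
    define U where "U = T - {d}"
    have U: "finite U" "U \<subseteq> D - {\<zero>}" "d \<notin> U" "T = insert d U" "card U < card T"
      using less.prems True card_Diff1_less[of T d] unfolding U_def by auto
    have cl: "inv d \<in> carrier R" "(\<Oplus>t\<in>U. inv t) \<in> carrier R" "d \<in> carrier R - {\<zero>}"
      using inv_nonzero(1)[OF subring_nonzero] less.prems finsum_inv_closed U subring_nonzero by auto
    have "of_natural 2 \<otimes> inv d = inv d \<oplus> inv d"
      using cl of_natural_add[of 1 1] by (simp add: l_distr numeral_2_eq_2)
    hence sum: "(\<Oplus>t\<in>T. inv t) \<oplus> inv d = (\<Oplus>t\<in>U. inv t) \<oplus> of_natural 2 \<otimes> inv d"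
      using finsum_inv_insert[of U d] U less.prems cl by (simp add: a_ac)
    from two show ?thesis
    proof
      assume "of_natural 2 = \<zero>"
      hence "(\<Oplus>t\<in>T. inv t) \<oplus> inv d = (\<Oplus>t\<in>U. inv t)" using sum cl by simp
      thus ?thesis unfolding unit_fraction_sums_iff using U by auto
    next
      assume "\<exists>h\<in>D. of_natural 2 \<otimes> h = \<one>"
      then obtain h where h: "h \<in> D" "of_natural 2 \<otimes> h = \<one>" by auto
      have hR: "h \<in> carrier R - {\<zero>}"
        using h subringE(1)[OF D] by auto
      have "inv h = of_natural 2" using h hR by (intro comm_inv_char) (auto simp: m_comm)
      hence "of_natural 2 \<otimes> inv d = inv (h \<otimes> d)"
        using inv_mult_nonzero[OF hR cl(3)] by simp
      moreover have "h \<otimes> d \<in> D - {\<zero>}"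
        using h hR less.prems cl(3) integral subringE(6)[OF D] by auto
      ultimately show ?thesis
        unfolding sum using less.hyps[OF U(5,1,2)] by simp
    qed
  qed
qed

lemma unit_fraction_sums_add_inv:
  assumes x: "x \<in> unit_fraction_sums D" and d: "d \<in> D - {\<zero>}"
  shows "x \<oplus> inv d \<in> unit_fraction_sums D"
proof -
  obtain T where T: "finite T" "T \<subseteq> D - {\<zero>}" "x = (\<Oplus>t\<in>T. inv t)"
    using x unfolding unit_fraction_sums_iff by auto
  show ?thesis
  proof (cases "\<exists>n>0. of_natural n = \<zero>")
    case True
    thus ?thesis using add_inv_if_two_zero_or_unit[OF two_zero_or_unit[OF D]] T d by auto
  next
    case False
    then obtain U where U: "finite U" "U \<subseteq> D - {\<zero>}" "U \<inter> T = {}" "(\<Oplus>t\<in>U. inv t) = inv d"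
      using inv_eq_sum_avoiding[OF _ D d T(1)] by blast
    have "(\<Oplus>t\<in>T \<union> U. inv t) = (\<Oplus>t\<in>T. inv t) \<oplus> (\<Oplus>t\<in>U. inv t)"
      using T U inv_nonzero(1)[OF subring_nonzero] by (intro finsum_Un_disjoint) auto
    thus ?thesis
      unfolding unit_fraction_sums_iff using T U by (intro exI[of _ "T \<union> U"]) auto
  qed
qed

lemma unit_fraction_sums_add:
  assumes x: "x \<in> unit_fraction_sums D" and "y \<in> unit_fraction_sums D"
  shows "x \<oplus> y \<in> unit_fraction_sums D"
proof -
  obtain T where T: "finite T" "T \<subseteq> D - {\<zero>}" "y = (\<Oplus>t\<in>T. inv t)"
    using assms(2) unfolding unit_fraction_sums_iff by auto
  have "x \<oplus> (\<Oplus>t\<in>T. inv t) \<in> unit_fraction_sums D"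
    using T(1,2)
  proof (induction T)
    case empty
    show ?case using x unit_fraction_sums_closed by simp
  next
    case (insert d T)
    hence cl: "inv d \<in> carrier R" "(\<Oplus>t\<in>T. inv t) \<in> carrier R" "x \<in> carrier R"
      using inv_nonzero(1)[OF subring_nonzero] finsum_inv_closed unit_fraction_sums_closed[OF x]
      by auto
    have "(x \<oplus> (\<Oplus>t\<in>T. inv t)) \<oplus> inv d \<in> unit_fraction_sums D"
      using insert by (intro unit_fraction_sums_add_inv) auto
    thus ?case using insert finsum_inv_insert[of T d] cl by (simp add: a_ac)
  qed
  thus ?thesis using T by simp
qed

end

text \<open>
  Multiplying every denominator by \<open>c\<close> divides the sum by \<open>c\<close> and keeps the denominators distinct.
  With \<open>E = D\<close> this is closure under multiplication by unit fractions; for a larger ring \<open>E\<close> it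
  turns denominators from \<open>E\<close> into denominators from \<open>D\<close>.
\<close>

lemma unit_fraction_sums_mult_inv:
  assumes D: "subring D R" and E: "subring E R"
    and c: "c \<in> D - {\<zero>}" "\<And>s. s \<in> E \<Longrightarrow> c \<otimes> s \<in> D" and x: "x \<in> unit_fraction_sums E"
  shows "inv c \<otimes> x \<in> unit_fraction_sums D"
proof -
  obtain T where T: "finite T" "T \<subseteq> E - {\<zero>}" "x = (\<Oplus>t\<in>T. inv t)"
    using x unfolding unit_fraction_sums_iff by auto
  have cR: "c \<in> carrier R - {\<zero>}" and TR: "T \<subseteq> carrier R - {\<zero>}"
    using subring_nonzero[OF D c(1)] T subring_nonzero[OF E] by auto
  have "c \<otimes> t \<in> D - {\<zero>}" if "t \<in> T" for t
    using that T TR c(2)[of t] cR integral[of c t] by auto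
  hence "(\<lambda>y. c \<otimes> y) ` T \<subseteq> D - {\<zero>}" by auto
  thus ?thesis
    unfolding unit_fraction_sums_iff using T finsum_inv_scale[OF cR T(1) TR]
    by (intro exI[of _ "(\<lambda>y. c \<otimes> y) ` T"]) auto
qed

lemma unit_fraction_sums_mult:
  assumes D: "subring D R" and x: "x \<in> unit_fraction_sums D" and "y \<in> unit_fraction_sums D"
  shows "x \<otimes> y \<in> unit_fraction_sums D"
proof -
  obtain T where T: "finite T" "T \<subseteq> D - {\<zero>}" "x = (\<Oplus>t\<in>T. inv t)"
    using x unfolding unit_fraction_sums_iff by auto
  have y: "y \<in> carrier R" using unit_fraction_sums_closed[OF D assms(3)] .
  have "(\<Oplus>t\<in>T. inv t) \<otimes> y \<in> unit_fraction_sums D"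
    using T(1,2)
  proof (induction T)
    case empty
    show ?case using y by (simp add: unit_fraction_sums_def)
  next
    case (insert d T)
    hence cl: "inv d \<in> carrier R" "(\<Oplus>t\<in>T. inv t) \<in> carrier R"
      using inv_nonzero(1)[OF subring_nonzero[OF D]] finsum_inv_closed[OF D] by auto
    have "inv d \<otimes> y \<oplus> (\<Oplus>t\<in>T. inv t) \<otimes> y \<in> unit_fraction_sums D"
      using insert assms(3) subringE(6)[OF D]
      by (intro unit_fraction_sums_add[OF D] unit_fraction_sums_mult_inv[OF D D]) auto
    thus ?case using insert finsum_inv_insert[OF D, of T d] cl y by (simp add: l_distr)
  qed
  thus ?thesis using T by simp
qed

section \<open>Fraction fields and conductors\<close>

lemma frac_fieldE:
  assumes "x \<in> frac_field R D"
  obtains a b where "a \<in> D" "b \<in> D - {\<zero>}" "x = a \<otimes> inv b"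
  using assms unfolding frac_field_def by auto

lemma frac_fieldI: "a \<in> D \<Longrightarrow> b \<in> D - {\<zero>} \<Longrightarrow> a \<otimes> inv b \<in> frac_field R D"
  unfolding frac_field_def by auto

lemma subset_frac_field:
  assumes "subring D R" shows "D \<subseteq> frac_field R D"
proof
  fix x assume "x \<in> D"
  thus "x \<in> frac_field R D"
    using frac_fieldI[of x D \<one>] subringE(1,3)[OF assms] by auto
qed

lemma subring_frac_field:
  assumes D: "subring D R" shows "subring (frac_field R D) R"
proof (rule subringI)
  show "frac_field R D \<subseteq> carrier R"
  proof
    fix x assume "x \<in> frac_field R D"
    then obtain a b where "a \<in> D" "b \<in> D - {\<zero>}" "x = a \<otimes> inv b" by (rule frac_fieldE)
    thus "x \<in> carrier R"
      using inv_nonzero(1)[OF subring_nonzero[OF D]] subringE(1)[OF D] by auto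
  qed
  show "\<one> \<in> frac_field R D" using subset_frac_field[OF D] subringE(3)[OF D] by auto
next
  fix x assume "x \<in> frac_field R D"
  then obtain a b where x: "a \<in> D" "b \<in> D - {\<zero>}" "x = a \<otimes> inv b" by (rule frac_fieldE)
  hence "\<ominus> x = (\<ominus> a) \<otimes> inv b"
    using subringE(1)[OF D] inv_nonzero(1)[OF subring_nonzero[OF D]] by (auto simp: l_minus)
  thus "\<ominus> x \<in> frac_field R D" using x subringE(5)[OF D] frac_fieldI by metis
next
  fix x y assume "x \<in> frac_field R D" "y \<in> frac_field R D"
  then obtain a b c d where x: "a \<in> D" "b \<in> D - {\<zero>}" "x = a \<otimes> inv b"
    and y: "c \<in> D" "d \<in> D - {\<zero>}" "y = c \<otimes> inv d" by (metis frac_fieldE)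
  have cl: "a \<in> carrier R" "b \<in> carrier R - {\<zero>}" "c \<in> carrier R" "d \<in> carrier R - {\<zero>}"
    using x y subringE(1)[OF D] by auto
  have bd: "b \<otimes> d \<in> D - {\<zero>}" using x y cl integral subringE(6)[OF D] by auto
  have "x \<oplus> y = (a \<otimes> d \<oplus> c \<otimes> b) \<otimes> inv (b \<otimes> d)"
    using add_fractions[OF cl] x y by simp
  thus "x \<oplus> y \<in> frac_field R D"
    using x y bd subringE(6,7)[OF D] by (auto intro!: frac_fieldI)
  have "x \<otimes> y = (a \<otimes> c) \<otimes> inv (b \<otimes> d)"
    using x y cl inv_nonzero(1)[OF cl(2)] inv_nonzero(1)[OF cl(4)]
    by (simp add: inv_mult_nonzero m_ac)
  thus "x \<otimes> y \<in> frac_field R D"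
    using x y bd subringE(6)[OF D] by (auto intro!: frac_fieldI)
qed

lemma frac_field_mono: "D \<subseteq> E \<Longrightarrow> frac_field R D \<subseteq> frac_field R E"
  unfolding frac_field_def by auto

lemma unit_fraction_sums_mono: "D \<subseteq> E \<Longrightarrow> unit_fraction_sums D \<subseteq> unit_fraction_sums E"
  unfolding unit_fraction_sums_def egyptian_element_def by blast

lemma inv_in_unit_fraction_sums:
  assumes D: "subring D R" and "d \<in> D - {\<zero>}" shows "inv d \<in> unit_fraction_sums D"
  using unit_fraction_sums_add_inv[OF D _ assms(2), of \<zero>]
    inv_nonzero(1)[OF subring_nonzero[OF assms]]
  by (simp add: unit_fraction_sums_def)

lemma frac_field_subset_unit_fraction_sums:
  assumes D: "subring D R" and "egyptian R D"
  shows "frac_field R D \<subseteq> unit_fraction_sums D"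
proof
  fix x assume "x \<in> frac_field R D"
  then obtain a b where x: "a \<in> D" "b \<in> D - {\<zero>}" "x = a \<otimes> inv b" by (rule frac_fieldE)
  thus "x \<in> unit_fraction_sums D"
    using assms inv_in_unit_fraction_sums[OF D] unit_fraction_sums_mult[OF D]
    unfolding egyptian_iff_subset by auto
qed

lemma egyptian_overring:
  assumes "subring D R" "egyptian R D" "D \<subseteq> E" "E \<subseteq> frac_field R D"
  shows "egyptian R E"
  using frac_field_subset_unit_fraction_sums[OF assms(1,2)] unit_fraction_sums_mono[OF assms(3)]
    assms(4) unfolding egyptian_iff_subset by blast

lemma egyptian_conductor_descent:
  assumes D: "subring D R" and E: "subring E R" and "D \<subseteq> E"
    and c: "c \<in> D - {\<zero>}" "\<And>s. s \<in> E \<Longrightarrow> c \<otimes> s \<in> D"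
    and "egyptian R E"
  shows "egyptian R D"
  unfolding egyptian_iff_subset
proof
  fix x assume "x \<in> D"
  have cR: "c \<in> carrier R - {\<zero>}" and xR: "x \<in> carrier R"
    using subring_nonzero[OF D c(1)] \<open>x \<in> D\<close> subringE(1)[OF D] by auto
  have "c \<otimes> x \<in> unit_fraction_sums E"
    using \<open>egyptian R E\<close> c \<open>x \<in> D\<close> \<open>D \<subseteq> E\<close> unfolding egyptian_iff_subset by blast
  hence "inv c \<otimes> (c \<otimes> x) \<in> unit_fraction_sums D"
    using unit_fraction_sums_mult_inv[OF D E c] by blast
  moreover have "inv c \<otimes> (c \<otimes> x) = x"
    using cR xR inv_nonzero[OF cR] by (simp add: m_assoc[symmetric])
  ultimately show "x \<in> unit_fraction_sums D" by simp
qed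

text \<open>
  The product of the denominators of the generators works.
\<close>

lemma Span_common_denominator:
  assumes D: "subring D R" and "set Us \<subseteq> frac_field R D"
  shows "\<exists>c \<in> D - {\<zero>}. \<forall>s \<in> Span D Us. c \<otimes> s \<in> D"
  using assms(2)
proof (induction Us)
  case Nil
  show ?case using subringE(1,2,3)[OF D] by (intro bexI[of _ \<one>]) auto
next
  case (Cons u Us)
  then obtain c where c: "c \<in> D - {\<zero>}" "\<And>s. s \<in> Span D Us \<Longrightarrow> c \<otimes> s \<in> D" by auto
  obtain a b where u: "a \<in> D" "b \<in> D - {\<zero>}" "u = a \<otimes> inv b"
    using Cons.prems frac_fieldE[of u D] by (metis list.set_intros(1) subsetD)
  have "set Us \<subseteq> carrier R"
    using Cons.prems subringE(1)[OF subring_frac_field[OF D]] by auto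
  hence Span: "Span D Us \<subseteq> carrier R"
    by (intro Span_in_carrier subringE(1)[OF D])
  have cl: "a \<in> carrier R" "b \<in> carrier R - {\<zero>}" "c \<in> carrier R - {\<zero>}" "inv b \<in> carrier R"
    using u c subringE(1)[OF D] inv_nonzero(1)[OF subring_nonzero[OF D]] by auto
  have "b \<otimes> c \<in> D - {\<zero>}" using u c cl integral subringE(6)[OF D] by auto
  moreover have "b \<otimes> c \<otimes> s \<in> D" if "s \<in> Span D (u # Us)" for s
  proof -
    have "s \<in> line_extension D u (Span D Us)" using that by simp
    then obtain k v where k: "k \<in> D" "v \<in> Span D Us" "s = k \<otimes> u \<oplus> v"
      unfolding line_extension_def r_coset_def set_add_def' by auto
    have kv: "k \<in> carrier R" "v \<in> carrier R" using k Span subringE(1)[OF D] by auto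
    have "b \<otimes> c \<otimes> s = c \<otimes> k \<otimes> a \<otimes> (b \<otimes> inv b) \<oplus> b \<otimes> (c \<otimes> v)"
      using k u cl kv by (simp add: r_distr m_ac)
    also have "\<dots> = c \<otimes> k \<otimes> a \<oplus> b \<otimes> (c \<otimes> v)"
      using cl kv inv_nonzero(2) by simp
    finally show ?thesis
      using k u c subringE(6,7)[OF D] by auto
  qed
  ultimately show ?case by blast
qed

section \<open>Localizations\<close>

lemma simple_extension_subset_frac_field:
  assumes D: "subring D R" and E: "subring E R" and f: "f \<in> E - {\<zero>}" and "D \<subseteq> E"
  shows "simple_extension D (inv f) \<subseteq> frac_field R E"
proof (rule simple_extension_subring_incl[OF subring_frac_field[OF E]])
  show "D \<subseteq> frac_field R E" using subset_frac_field[OF E] assms(4) by auto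
  show "inv f \<in> frac_field R E"
    using frac_fieldI[of \<one> E f] subringE(3)[OF E] f inv_nonzero(1)[OF subring_nonzero[OF E f]] by auto
qed

text \<open>
  The same \<open>f\<close> works: \<open>E[1/f]\<close> lies between \<open>D[1/f]\<close> and the fraction field.
\<close>

lemma generically_egyptian_overring:
  assumes D: "subring D R" and E: "subring E R" and "D \<subseteq> E" "E \<subseteq> frac_field R D"
    and "generically_egyptian R D"
  shows "generically_egyptian R E"
proof -
  obtain f where f: "f \<in> D - {\<zero>}" "egyptian R (simple_extension D (inv f))"
    using assms(5) unfolding generically_egyptian_def by auto
  have inv_f: "inv f \<in> carrier R" using inv_nonzero(1)[OF subring_nonzero[OF D f(1)]] by auto
  let ?D' = "simple_extension D (inv f)" 
  have D': "subring ?D' R" by (rule simple_extension_is_subring[OF D inv_f])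
  have DD': "D \<subseteq> ?D'" by (rule simple_extension_incl[OF subringE(1)[OF D] inv_f])
  have "simple_extension E (inv f) \<subseteq> frac_field R ?D'"
  proof (rule simple_extension_subring_incl[OF subring_frac_field[OF D']])
    show "E \<subseteq> frac_field R ?D'" using assms(4) frac_field_mono[OF DD'] by auto
    show "inv f \<in> frac_field R ?D'"
      using simple_extension_mem[OF D inv_f] subset_frac_field[OF D'] by auto
  qed
  hence "egyptian R (simple_extension E (inv f))"
    by (rule egyptian_overring[OF D' f(2) mono_simple_extension[OF assms(3)]])
  thus ?thesis using f(1) assms(3) unfolding generically_egyptian_def by auto
qed

text \<open>
  Invert \<open>h = c f\<close> in \<open>D\<close>. Every \<open>s \<in> E\<close> equals \<open>c (f s) / h\<close> with \<open>c (f s) \<in> D\<close>, and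
  \<open>1/f = c / h\<close>; so \<open>D[1/h]\<close> is an overring of the Egyptian ring \<open>E[1/f]\<close>.
\<close>

lemma generically_egyptian_conductor_descent:
  assumes D: "subring D R" and E: "subring E R" and "D \<subseteq> E"
    and c: "c \<in> D - {\<zero>}" "\<And>s. s \<in> E \<Longrightarrow> c \<otimes> s \<in> D"
    and "generically_egyptian R E"
  shows "generically_egyptian R D"
proof -
  obtain f where f: "f \<in> E - {\<zero>}" "egyptian R (simple_extension E (inv f))"
    using assms(6) unfolding generically_egyptian_def by auto
  have cR: "c \<in> carrier R - {\<zero>}" and fR: "f \<in> carrier R - {\<zero>}"
    using subring_nonzero[OF D c(1)] subring_nonzero[OF E f(1)] .
  have inv_f: "inv f \<in> carrier R" and inv_c: "inv c \<in> carrier R"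
    using inv_nonzero(1) cR fR by auto
  let ?h = "c \<otimes> f"
  have h: "?h \<in> D - {\<zero>}" using c f cR fR integral by auto
  have inv_h: "inv ?h = inv c \<otimes> inv f" "inv ?h \<in> carrier R"
    using inv_mult_nonzero[OF cR fR] inv_f inv_c by auto
  let ?L = "simple_extension D (inv ?h)"
  let ?M = "simple_extension E (inv f)"
  have L: "subring ?L R" by (rule simple_extension_is_subring[OF D inv_h(2)])
  have M: "subring ?M R" by (rule simple_extension_is_subring[OF E inv_f])
  have DL: "D \<subseteq> ?L" by (rule simple_extension_incl[OF subringE(1)[OF D] inv_h(2)])
  have EM: "E \<subseteq> ?M" by (rule simple_extension_incl[OF subringE(1)[OF E] inv_f])
  have hL: "inv ?h \<in> ?L" by (rule simple_extension_mem[OF D inv_h(2)])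
  have "?M \<subseteq> ?L"
  proof (rule simple_extension_subring_incl[OF L])
    show "E \<subseteq> ?L"
    proof
      fix s assume s: "s \<in> E"
      hence sR: "s \<in> carrier R" using subringE(1)[OF E] by auto
      have "c \<otimes> (f \<otimes> s) \<in> D" using c s f subringE(6)[OF E] by auto
      hence "inv ?h \<otimes> (c \<otimes> (f \<otimes> s)) \<in> ?L" using hL DL subringE(6)[OF L] by auto
      moreover have "inv ?h \<otimes> (c \<otimes> (f \<otimes> s)) = (inv ?h \<otimes> ?h) \<otimes> s"
        using inv_h(2) cR fR sR by (simp add: m_assoc)
      moreover have "inv ?h \<otimes> ?h = \<one>"
        using inv_nonzero(3)[OF subring_nonzero[OF D h]] .
      ultimately show "s \<in> ?L" using sR by simp
    qed
    have "inv f = c \<otimes> inv ?h"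
      unfolding inv_h(1) using cR inv_c inv_f inv_nonzero(2)[OF cR] by (simp add: m_assoc[symmetric])
    thus "inv f \<in> ?L" using hL DL c(1) subringE(6)[OF L] by auto
  qed
  moreover have "?L \<subseteq> frac_field R ?M"
    using h assms(3) EM by (intro simple_extension_subset_frac_field[OF D M]) auto
  ultimately have "egyptian R ?L" by (rule egyptian_overring[OF M f(2)])
  thus ?thesis using h unfolding generically_egyptian_def by auto
qed

end

theorem corollary4p3:
  fixes K :: "('a, 'b) ring_scheme" and R S :: "'a set"
  assumes "field K"
    and "subdomain R K" and "subdomain S K" and "R \<subseteq> S"
    and "frac_field K R = frac_field K S"
    and "module_finite K R S"
  shows "(egyptian K R \<longleftrightarrow> egyptian K S) \<and>
         (generically_egyptian K R \<longleftrightarrow> generically_egyptian K S)"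
proof -
  interpret field K by fact
  have R: "subring R K" and S: "subring S K"
    using assms(2,3) subdomain.axioms(1) subcring.axioms(1) by blast+
  have S_frac: "S \<subseteq> frac_field K R" using subset_frac_field[OF S] assms(5) by simp
  obtain Us where "set Us \<subseteq> S" "S = Span R Us"
    using assms(6) unfolding module_finite_def by auto
  then obtain c where c: "c \<in> R - {\<zero>\<^bsub>K\<^esub>}" "\<And>s. s \<in> S \<Longrightarrow> c \<otimes>\<^bsub>K\<^esub> s \<in> R"
    using Span_common_denominator[OF R, of Us] S_frac by blast
  show ?thesis
    using egyptian_overring[OF R _ assms(4) S_frac]
      egyptian_conductor_descent[OF R S assms(4) c]
      generically_egyptian_overring[OF R S assms(4) S_frac]
      generically_egyptian_conductor_descent[OF R S assms(4) c]
    by blast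
qed

end
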